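(* Let $d\ge1$. For every bounded set $S\subset M_d(\mathbb{C})$ we have $$\max_{1\le k\le 2d^3}\Lambda(S^k)^{\frac1k}\ge \frac{1}{2^8d^5}\,\rho(S).$$ In particular, $$\max_{1\le k\le N_2(d)}\Lambda(S^k)^{\frac1k}\ge\frac12\,\rho(S),$$ where $N_2(d)=2d^3\lceil 8+5\log_2 d\rceil$.
   Context: $M_d(\mathbb{C})$ is the ring of $d\times d$ complex matrices. For $S\subset M_d(\mathbb{C})$ and $k\ge1$, $S^k:=\{s_1\cdots s_k : s_i\in S\}$ is the $k$-fold product set. Given a norm $\|\cdot\|$ on $\mathbb{C}^d$, the same symbol denotes its associated operator norm on $M_d(\mathbb{C})$, and $\|S\|:=\sup_{s\in S}\|s\|$. The joint spectral radius of a bounded set $S$ is $\rho(S):=\lim_{n\to+\infty}\|S^n\|^{1/n}$ (the limit exists and does not depend on the norm). For $s\in M_d(\mathbb{C})$, $\Lambda(s)$ is the largest modulus of an eigenvalue of $s$, and $\Lambda(S):=\sup_{s\in S}\Lambda(s)$. *)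

theory Defs
  imports "HOL-Analysis.Analysis"
begin

(* Square matrices carry the componentwise ring structure as type-class instance, so the library
   powers and set products of that instance are not the matrix ones; we multiply with **. *)
definition product_set :: "(complex^'n^'n) set \<Rightarrow> nat \<Rightarrow> (complex^'n^'n) set" where
  "product_set S k = {foldr (**) xs (mat 1) | xs. length xs = k \<and> set xs \<subseteq> S}"

(* The supremum of a set of nonnegative quantities; hence 0 for the empty set,
   where the conditionally complete Sup on the reals is unspecified. *)
definition sup_nonneg :: "('a \<Rightarrow> real) \<Rightarrow> 'a set \<Rightarrow> real" where
  "sup_nonneg f S = (if S = {} then 0 else (SUP s\<in>S. f s))"

(* The operator norm is the one induced by the Euclidean norm; the joint spectral radius
   does not depend on the choice of the norm. *)
definition set_opnorm :: "(complex^'n^'n) set \<Rightarrow> real" where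
  "set_opnorm S = sup_nonneg (\<lambda>s. onorm ((*v) s)) S"

definition joint_spectral_radius :: "(complex^'n^'n) set \<Rightarrow> real" where
  "joint_spectral_radius S = lim (\<lambda>n. root n (set_opnorm (product_set S n)))"

definition matrix_eigenvalue :: "complex^'n^'n \<Rightarrow> complex \<Rightarrow> bool" where
  "matrix_eigenvalue A c \<longleftrightarrow> (\<exists>v. v \<noteq> 0 \<and> A *v v = c *s v)"

definition max_eigenvalue_modulus :: "complex^'n^'n \<Rightarrow> real" where
  "max_eigenvalue_modulus A = Max {cmod c | c. matrix_eigenvalue A c}"

definition set_eigenvalue_modulus :: "(complex^'n^'n) set \<Rightarrow> real" where
  "set_eigenvalue_modulus S = sup_nonneg max_eigenvalue_modulus S"

definition N2_bound :: "nat \<Rightarrow> nat" where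
  "N2_bound d = 2 * d^3 * nat \<lceil>8 + 5 * log 2 (real d)\<rceil>"

end

theory Submission
  imports Defs "Jordan_Normal_Form.Schur_Decomposition"
begin

text \<open>
  Let \<open>T\<close> be bounded, \<open>r > 0\<close> and \<open>\<parallel>T\<^sup>n\<parallel> \<ge> r\<^sup>n\<close> for all \<open>n \<ge> 1\<close>. Consider the bounded set
  \<open>X\<close> of all vectors \<open>(n+1) r\<^bsup>-n\<^esup> w x\<close> with \<open>n \<le> N\<close>, \<open>w \<in> T\<^sup>n\<close>, \<open>\<parallel>x\<parallel> \<le> 1\<close>, and choose
  \<open>e\<^sub>1, \<dots>, e\<^sub>d\<close> in \<open>X\<close> whose determinant is at least half of the supremum. By Cramer's rule every
  point of \<open>X\<close> has coordinates of modulus at most 2 in this basis. Each \<open>e\<^sub>i\<close> is either of norm at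
  most 1 or of the form \<open>q t\<^sub>i y\<close> with \<open>t\<^sub>i \<in> T\<close>, \<open>y \<in> X\<close> and \<open>q \<le> 2/r\<close>. Hence \<open>e = W e + O(1)\<close>
  for the block matrix \<open>W\<close> with blocks \<open>c\<^sub>i\<^sub>j t\<^sub>i\<close>, \<open>\<bar>c\<^sub>i\<^sub>j\<bar> \<le> 4/r\<close>, while \<open>\<parallel>e\<parallel>\<close> tends to infinity
  with \<open>N\<close>; a limit of these matrices \<open>W\<close>, of size \<open>d\<^sup>2\<close>, has the eigenvalue 1. The trace of \<open>W\<^sup>k\<close>
  is a combination of traces of elements of \<open>T\<^sup>k\<close>, so it is at most \<open>d\<^sup>2 (4d/r)\<^sup>k \<Lambda>(T\<^sup>k)\<close>.
  If all the \<open>\<Lambda>(T\<^sup>k)\<close> with \<open>k \<le> d\<^sup>2\<close> were smaller than \<open>(r / 8d\<^sup>3)\<^sup>k\<close>, Newton's identities would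
  make the characteristic polynomial of \<open>W\<close> so close to a monomial that 1 could not be a root.
  The theorem follows for \<open>T = S\<^sup>q\<close> and \<open>r = \<rho>(S)\<^sup>q\<close>, with \<open>q = 1\<close> for the first inequality and
  \<open>q = \<lceil>8 + 5 log\<^sub>2 d\<rceil>\<close> for the second one.
\<close>

hide_const (open) Matrix.mat Matrix.vec Matrix.row Determinant.det
no_notation vec_index (infixl "$" 100)
no_notation fps_nth (infixl "$" 75)

section \<open>Eigenvalues, traces and power sums\<close>

text \<open>Powers of a triangular matrix stay triangular, and their diagonals multiply
  entrywise.\<close>

lemma trace_power_upper_triangular:
  fixes T :: "complex mat"
  assumes T: "T \<in> carrier_mat n n" and ut: "upper_triangular T"
  shows "(\<Sum>i<n. (T ^\<^sub>m m) $$ (i,i)) = (\<Sum>x\<leftarrow>diag_mat T. x ^ m)"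
proof -
  have pow: "(\<forall>i<n. \<forall>j<i. (T ^\<^sub>m m) $$ (i,j) = 0) \<and> (\<forall>i<n. (T ^\<^sub>m m) $$ (i,i) = (T $$ (i,i)) ^ m)"
  proof (induction m)
    case 0
    then show ?case using T by auto
  next
    case (Suc m)
    have P: "T ^\<^sub>m m \<in> carrier_mat n n" using T by simp
    have entry: "(T ^\<^sub>m Suc m) $$ (i,j) = (\<Sum>l<n. (T ^\<^sub>m m) $$ (i,l) * T $$ (l,j))"
      if "i < n" "j < n" for i j
      using that T P by (simp add: scalar_prod_def lessThan_atLeast0)
    have T0: "T $$ (l,j) = 0" if "l < n" "j < l" for l j
      using ut T that by auto
    have "(T ^\<^sub>m Suc m) $$ (i,j) = 0" if "i < n" "j < i" for i j
    proof -
      have "(T ^\<^sub>m m) $$ (i,l) * T $$ (l,j) = 0" if "l < n" for l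
        using Suc.IH T0[OF that, of j] \<open>i < n\<close> \<open>j < i\<close> by (cases "l < i") auto
      then have "(\<Sum>l<n. (T ^\<^sub>m m) $$ (i,l) * T $$ (l,j)) = 0"
        by (intro sum.neutral) auto
      then show ?thesis using entry[of i j] that by simp
    qed
    moreover have "(T ^\<^sub>m Suc m) $$ (i,i) = (T $$ (i,i)) ^ Suc m" if "i < n" for i
    proof -
      have "(\<Sum>l<n. (T ^\<^sub>m m) $$ (i,l) * T $$ (l,i)) = (\<Sum>l\<in>{i}. (T ^\<^sub>m m) $$ (i,l) * T $$ (l,i))"
        using Suc.IH that T0[of _ i] by (intro sum.mono_neutral_right) (auto, metis nat_neq_iff)
      then show ?thesis using entry[of i i] that Suc.IH by simp
    qed
    ultimately show ?case by blast
  qed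
  have "(\<Sum>x\<leftarrow>diag_mat T. x ^ m) = (\<Sum>i\<leftarrow>[0..<n]. (T $$ (i,i)) ^ m)"
    using T by (simp add: diag_mat_def comp_def)
  also have "\<dots> = (\<Sum>i<n. (T $$ (i,i)) ^ m)"
    by (simp add: sum_list_distinct_conv_sum_set lessThan_atLeast0)
  finally show ?thesis using pow by simp
qed

text \<open>Cyclicity of the trace lets \<open>P\<close> and its inverse \<open>Q\<close>
  cancel.\<close>

lemma trace_similar_mat_wit:
  fixes A :: "complex mat"
  assumes "A \<in> carrier_mat n n" and wit: "similar_mat_wit A B P Q"
  shows "(\<Sum>i<n. A $$ (i,i)) = (\<Sum>i<n. B $$ (i,i))"
proof -
  have car: "A \<in> carrier_mat n n" "B \<in> carrier_mat n n" "P \<in> carrier_mat n n" "Q \<in> carrier_mat n n"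
    and eq: "Q * P = 1\<^sub>m n" "A = P * B * Q"
    using similar_mat_witD2[OF assms] by auto
  have comm: "(\<Sum>i<n. (X * Y) $$ (i,i)) = (\<Sum>i<n. (Y * X) $$ (i,i))"
    if "X \<in> carrier_mat n n" "Y \<in> carrier_mat n n" for X Y :: "complex mat"
  proof -
    have "(\<Sum>i<n. (X * Y) $$ (i,i)) = (\<Sum>i<n. \<Sum>l<n. X $$ (i,l) * Y $$ (l,i))"
      using that by (intro sum.cong) (auto simp: scalar_prod_def lessThan_atLeast0)
    also have "\<dots> = (\<Sum>l<n. \<Sum>i<n. Y $$ (l,i) * X $$ (i,l))"
      by (subst sum.swap) (simp add: mult.commute)
    also have "\<dots> = (\<Sum>i<n. (Y * X) $$ (i,i))"
      using that by (intro sum.cong) (auto simp: scalar_prod_def lessThan_atLeast0)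
    finally show ?thesis .
  qed
  have "A = P * (B * Q)" using eq car by (simp add: assoc_mult_mat)
  then have "(\<Sum>i<n. A $$ (i,i)) = (\<Sum>i<n. (B * Q * P) $$ (i,i))"
    using comm[of P "B * Q"] car by simp
  also have "B * Q * P = B" using eq car by (simp add: assoc_mult_mat)
  finally show ?thesis .
qed

text \<open>Schur triangularisation puts the roots of the characteristic polynomial, with
  multiplicity, on the diagonal. The power is written as an iterate because \<open>^\<close> would
  be the componentwise power.\<close>

lemma complex_matrix_eigenvalue_list:
  fixes A :: "complex^'k^'k"
  obtains es where "length es = CARD('k)"
    and "\<And>m. trace (((**) A ^^ m) (mat 1)) = (\<Sum>x\<leftarrow>es. x ^ m)"
    and "\<And>c. matrix_eigenvalue A c \<longleftrightarrow> c \<in> set es"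
proof -
  define n where "n = CARD('k)"
  obtain g :: "nat \<Rightarrow> 'k" where g: "bij_betw g {..<n} UNIV"
    using ex_bij_betw_nat_finite[of "UNIV :: 'k set"] unfolding n_def lessThan_atLeast0 by auto
  have inj: "g i = g j \<longleftrightarrow> i = j" if "i < n" "j < n" for i j
    using g that by (auto simp: bij_betw_def inj_on_def)
  have reindex: "(\<Sum>x\<in>UNIV. h x) = (\<Sum>i<n. h (g i))" for h :: "'k \<Rightarrow> complex"
    using sum.reindex_bij_betw[OF g, of h] by simp
  define tm where "tm = (\<lambda>X :: complex^'k^'k. Matrix.mat n n (\<lambda>(i,j). X $ g i $ g j))"
  have car: "tm X \<in> carrier_mat n n" for X by (simp add: tm_def)
  have tm_mult: "tm (X ** Y) = tm X * tm Y" for X Y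
    by (rule eq_matI) (auto simp: tm_def scalar_prod_def matrix_matrix_mult_def reindex lessThan_atLeast0)
  have tm_one: "tm (mat 1) = 1\<^sub>m n"
    by (rule eq_matI) (auto simp: tm_def Finite_Cartesian_Product.mat_def inj)
  have tm_trace: "trace X = (\<Sum>i<n. tm X $$ (i,i))" for X
    by (simp add: trace_def reindex tm_def)
  define B where "B = tm A"
  have B: "B \<in> carrier_mat n n" by (simp add: B_def car)
  have comm: "B * B ^\<^sub>m m = B ^\<^sub>m m * B" for m
  proof (induction m)
    case (Suc m)
    have P: "B ^\<^sub>m m \<in> carrier_mat n n" using B by simp
    have "B * (B ^\<^sub>m m * B) = (B * B ^\<^sub>m m) * B" using assoc_mult_mat[OF B P B] by simp
    then show ?case using Suc by simp
  qed (use B in simp)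
  have pow: "tm (((**) A ^^ m) (mat 1)) = B ^\<^sub>m m" for m
  proof (induction m)
    case 0
    then show ?case using B by (simp add: tm_one)
  next
    case (Suc m)
    then show ?case using comm[of m] by (simp add: tm_mult B_def)
  qed
  obtain es where es: "char_poly B = (\<Prod>a\<leftarrow>es. [:- a, 1:])" "length es = n"
    using char_poly_factorized[OF B] by blast
  obtain T P Q where TPQ: "schur_decomposition B es = (T, P, Q)"
    by (cases "schur_decomposition B es")
  from schur_decomposition[OF B es(1) TPQ]
  have wit: "similar_mat_wit B T P Q" and ut: "upper_triangular T" and diag: "diag_mat T = es" by auto
  have T: "T \<in> carrier_mat n n" using similar_mat_witD2[OF B wit] by auto
  have "trace (((**) A ^^ m) (mat 1)) = (\<Sum>x\<leftarrow>es. x ^ m)" for m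
  proof -
    have "(\<Sum>i<n. (B ^\<^sub>m m) $$ (i,i)) = (\<Sum>i<n. (T ^\<^sub>m m) $$ (i,i))"
      using trace_similar_mat_wit[OF _ similar_mat_wit_pow[OF wit]] B by simp
    then show ?thesis
      using trace_power_upper_triangular[OF T ut] diag by (simp add: tm_trace pow)
  qed
  moreover have "matrix_eigenvalue A c \<longleftrightarrow> c \<in> set es" for c
  proof -
    have "eigenvalue B c \<longleftrightarrow> c \<in> set es"
      unfolding eigenvalue_root_char_poly[OF B] es(1) by (auto simp: poly_prod_list prod_list_zero_iff)
    moreover have "matrix_eigenvalue A c \<longleftrightarrow> eigenvalue B c"
    proof
      assume "matrix_eigenvalue A c"
      then obtain v where v: "v \<noteq> 0" "A *v v = c *s v" unfolding matrix_eigenvalue_def by blast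
      define u where "u = Matrix.vec n (\<lambda>i. v $ g i)"
      obtain k where k: "v $ k \<noteq> 0" using v(1) by (auto simp: Finite_Cartesian_Product.vec_eq_iff)
      obtain i where i: "i < n" "g i = k" using g by (metis UNIV_I bij_betw_def imageE lessThan_iff)
      have "vec_index u i \<noteq> 0" using i k by (simp add: u_def)
      then have "u \<noteq> 0\<^sub>v n" using i by auto
      moreover have "B *\<^sub>v u = c \<cdot>\<^sub>v u"
      proof (rule eq_vecI)
        fix i assume "i < dim_vec (c \<cdot>\<^sub>v u)"
        then have i: "i < n" by (simp add: u_def)
        have "(A *v v) $ g i = c * v $ g i" using v(2) by simp
        then show "vec_index (B *\<^sub>v u) i = vec_index (c \<cdot>\<^sub>v u) i"
          using i by (simp add: u_def B_def tm_def scalar_prod_def matrix_vector_mult_def reindex lessThan_atLeast0)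
      qed (use B in \<open>simp add: u_def\<close>)
      ultimately show "eigenvalue B c"
        unfolding eigenvalue_def eigenvector_def using B by (intro exI[of _ u]) (auto simp: u_def)
    next
      assume "eigenvalue B c"
      then obtain u where u: "u \<in> carrier_vec n" "u \<noteq> 0\<^sub>v n" "B *\<^sub>v u = c \<cdot>\<^sub>v u"
        unfolding eigenvalue_def eigenvector_def using B by auto
      define h where "h = the_inv_into {..<n} g"
      have h: "h (g i) = i" if "i < n" for i
        using g that by (auto simp: h_def bij_betw_def intro!: the_inv_into_f_f)
      define v where "v = (\<chi> k. vec_index u (h k))"
      obtain i where i: "i < n" "vec_index u i \<noteq> 0" using u(1,2) by (metis carrier_vecD eq_vecI index_zero_vec(1) index_zero_vec(2))
      have "v $ g i \<noteq> 0" using i by (simp add: v_def h)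
      then have "v \<noteq> 0" by auto
      moreover have "A *v v = c *s v"
      proof -
        have "(A *v v) $ k = (c *s v) $ k" for k
        proof -
          obtain i where i: "i < n" "g i = k" using g by (metis UNIV_I bij_betw_def imageE lessThan_iff)
          have "vec_index (B *\<^sub>v u) i = c * vec_index u i" using u i by simp
          then show ?thesis
            using i u(1) by (auto simp: v_def B_def tm_def scalar_prod_def matrix_vector_mult_def reindex lessThan_atLeast0 h
               intro!: sum.cong)
        qed
        then show ?thesis by (simp add: Finite_Cartesian_Product.vec_eq_iff)
      qed
      ultimately show "matrix_eigenvalue A c" unfolding matrix_eigenvalue_def by blast
    qed
    ultimately show ?thesis by simp
  qed
  ultimately show ?thesis using that[of es] es(2) n_def by blast
qed

text \<open>\<open>Q\<close> reverses the monic polynomial with roots \<open>es\<close>. If L is the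
  generating series of the power sums from degree 1 on, then X Q' = - L Q; the identity compares
  coefficients.\<close>

lemma newton_identity:
  fixes es :: "complex list"
  defines "Q \<equiv> \<Prod>x\<leftarrow>es. [:1, - x:]"
  shows "of_nat n * coeff Q n = - (\<Sum>k=1..n. (\<Sum>x\<leftarrow>es. x ^ k) * coeff Q (n - k))"
proof -
  define L where "L = (\<lambda>es :: complex list. Abs_fps (\<lambda>k. if k = 0 then 0 else \<Sum>x\<leftarrow>es. x ^ k))"
  have L_Cons: "L (x # es) = L [x] + L es" for x es
    by (simp add: L_def fps_eq_iff)
  \<comment> \<open>Geometric series: \<open>L [x]\<close> is xX / (1 - xX).\<close>
  have single: "fps_X * fps_deriv (fps_of_poly [:1, - x:]) = - (fps_of_poly [:1, - x:] * L [x])" for x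
  proof (rule fps_ext)
    fix n
    show "fps_nth (fps_X * fps_deriv (fps_of_poly [:1, - x:])) n = fps_nth (- (fps_of_poly [:1, - x:] * L [x])) n"
    proof (cases n)
      case 0 then show ?thesis by (simp add: L_def)
    next
      case (Suc m)
      have eq: "fps_of_poly [:1, - x:] = 1 - fps_const x * fps_X"
        by (simp add: fps_of_poly_pCons)
      show ?thesis
        unfolding Suc eq by (cases m) (simp_all add: L_def left_diff_distrib mult.assoc)
    qed
  qed
  \<comment> \<open>Logarithmic derivatives add up over the factors, as \<open>L\<close> does over
    the list.\<close>
  have "fps_X * fps_deriv (fps_of_poly (\<Prod>x\<leftarrow>es. [:1, - x:])) = - (fps_of_poly (\<Prod>x\<leftarrow>es. [:1, - x:]) * L es)" for es
  proof (induction es)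
    case Nil
    then show ?case by (simp add: L_def fps_eq_iff)
  next
    case (Cons x es)
    let ?a = "fps_of_poly [:1, - x:]" and ?b = "fps_of_poly (\<Prod>x\<leftarrow>es. [:1, - x:])"
    have "fps_X * fps_deriv (?a * ?b) = (fps_X * fps_deriv ?a) * ?b + ?a * (fps_X * fps_deriv ?b)"
      by (simp add: algebra_simps)
    also have "\<dots> = - (?a * ?b * L (x # es))"
      unfolding single Cons L_Cons[of x es] by (simp add: algebra_simps)
    finally show ?case by (simp only: list.map prod_list.Cons fps_of_poly_mult)
  qed
  from this[of es] have "fps_X * fps_deriv (fps_of_poly Q) = - (L es * fps_of_poly Q)"
    by (simp add: Q_def mult.commute)
  then have "fps_nth (fps_X * fps_deriv (fps_of_poly Q)) n = - (\<Sum>k=0..n. fps_nth (L es) k * coeff Q (n - k))"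
    by (simp add: fps_mult_nth)
  moreover have "(\<Sum>k=0..n. fps_nth (L es) k * coeff Q (n - k)) = (\<Sum>k=1..n. (\<Sum>x\<leftarrow>es. x ^ k) * coeff Q (n - k))"
    by (rule sum.mono_neutral_cong_right) (auto simp: L_def)
  moreover have "fps_nth (fps_X * fps_deriv (fps_of_poly Q)) n = of_nat n * coeff Q n"
    by (cases n) auto
  ultimately show ?thesis by simp
qed

text \<open>By Newton's identities, small power sums force small coefficients of the reversed
  polynomial. Its value at 1 then differs from the constant term 1 by less than 1 and cannot
  vanish.\<close>

lemma power_sums_small_imp_one_notin:
  fixes es :: "complex list" and \<delta> :: real
  assumes D: "length es \<le> D" and "\<delta> \<ge> 0" and small: "real D * \<delta> \<le> 1/2"
    and p: "\<And>k. k \<in> {1..D} \<Longrightarrow> cmod (\<Sum>x\<leftarrow>es. x ^ k) \<le> real D * \<delta> ^ k"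
  shows "1 \<notin> set es"
proof
  assume one: "1 \<in> set es"
  define Q where "Q = (\<Prod>x\<leftarrow>es. [:1, - x:])"
  define \<eta> where "\<eta> = real D * \<delta>"
  have "\<eta> \<ge> 0" using assms by (simp add: \<eta>_def)
  have D1: "D \<ge> 1" using one D by (cases es) auto
  have Q0: "coeff Q 0 = 1"
    unfolding Q_def by (induction es) (auto simp: coeff_mult_0)
  have degQ: "degree Q \<le> D"
  proof -
    have "degree (\<Prod>x\<leftarrow>es. [:1, - x:]) \<le> length es"
    proof (induction es)
      case (Cons x es)
      have "degree ([:1, - x:] * (\<Prod>x\<leftarrow>es. [:1, - x:])) \<le> degree [:1, - x:] + degree (\<Prod>x\<leftarrow>es. [:1, - x:])"
        by (rule degree_mult_le)
      also have "degree [:1, - x:] \<le> 1" by simp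
      finally show ?case using Cons by simp
    qed simp
    then show ?thesis using D by (simp add: Q_def)
  qed
  have root: "poly Q 1 = 0"
    unfolding Q_def using one by (induction es) auto
  have "cmod (coeff Q n) \<le> \<eta> ^ n" if "n \<le> D" for n
    using that
  proof (induction n rule: less_induct)
    case (less n)
    show ?case
    proof (cases "n = 0")
      case True then show ?thesis using Q0 by simp
    next
      case False
      have "real n * cmod (coeff Q n) = cmod (\<Sum>k=1..n. (\<Sum>x\<leftarrow>es. x ^ k) * coeff Q (n - k))"
        using newton_identity[of n es] by (metis Q_def norm_minus_cancel norm_mult norm_of_nat)
      \<comment> \<open>Each term is at most \<open>\<eta> ^ n\<close>, since
        \<open>D * \<delta> ^ k \<le> (D * \<delta>) ^ k\<close> for \<open>k \<ge> 1\<close>; the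
        number \<open>n\<close> of terms cancels the factor on the left.\<close>
      also have "\<dots> \<le> (\<Sum>k=1..n. \<eta> ^ n)"
      proof (rule sum_norm_le)
        fix k assume k: "k \<in> {1..n}"
        have "cmod ((\<Sum>x\<leftarrow>es. x ^ k) * coeff Q (n - k)) \<le> (real D * \<delta> ^ k) * \<eta> ^ (n - k)"
          unfolding norm_mult using p[of k] less k \<open>\<delta> \<ge> 0\<close> by (intro mult_mono) auto
        also have "real D * \<delta> ^ k \<le> \<eta> ^ k"
          using self_le_power[of "real D" k] D1 k \<open>\<delta> \<ge> 0\<close>
          by (auto simp: \<eta>_def power_mult_distrib intro!: mult_right_mono)
        finally show "cmod ((\<Sum>x\<leftarrow>es. x ^ k) * coeff Q (n - k)) \<le> \<eta> ^ n"
          using k \<open>\<eta> \<ge> 0\<close> by (simp add: mult_right_mono flip: power_add)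
      qed
      finally show ?thesis using False by simp
    qed
  qed
  then have bound: "cmod (coeff Q n) \<le> (1/2) ^ n" if "n \<le> D" for n
    using that power_mono[of \<eta> "1/2" n] small \<open>\<eta> \<ge> 0\<close> unfolding \<eta>_def[symmetric] by fastforce
  have "0 = (\<Sum>n\<le>degree Q. coeff Q n)"
    using root by (simp add: poly_altdef)
  also have "\<dots> = (\<Sum>n\<le>D. coeff Q n)"
    using degQ by (intro sum.mono_neutral_left) (auto simp: coeff_eq_0)
  also have "\<dots> = 1 + (\<Sum>n=1..D. coeff Q n)"
    using Q0 by (simp add: sum.atLeast1_atMost_eq sum.atMost_shift lessThan_Suc_atMost)
  finally have "1 = cmod (\<Sum>n=1..D. coeff Q n)"
    by (metis add_eq_0_iff norm_minus_cancel norm_one)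
  \<comment> \<open>The finite geometric sum falls short of 1 by \<open>(1/2) ^ D\<close>, whence
    the contradiction.\<close>
  also have "\<dots> \<le> (\<Sum>n=1..D. (1/2) ^ n)"
    using bound by (intro sum_norm_le) auto
  also have "\<dots> = 1 - (1/2) ^ D"
    by (induction D) auto
  finally have "(1/2 :: real) ^ D \<le> 0" by simp
  moreover have "(1/2 :: real) ^ D > 0" by (rule zero_less_power) simp
  ultimately show False by linarith
qed

section \<open>Product sets and the joint spectral radius\<close>

text \<open>Fekete's lemma in multiplicative form: the limit is the infimum of the roots, so it
  bounds each of them from below. Roots instead of logarithms admit the value 0.\<close>

lemma submultiplicative_root_limit:
  fixes u :: "nat \<Rightarrow> real"
  assumes nonneg: "\<And>n. u n \<ge> 0" and sub: "\<And>m n. u (m + n) \<le> u m * u n"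
  obtains L where "(\<lambda>n. root n (u n)) \<longlonglongrightarrow> L" "L \<ge> 0" "\<And>n. n \<ge> 1 \<Longrightarrow> L ^ n \<le> u n"
proof -
  \<comment> \<open>Index 0 is excluded because \<open>root 0\<close> is constantly 0.\<close>
  define L where "L = (INF n\<in>{1..}. root n (u n))"
  have bdd: "bdd_below ((\<lambda>n. root n (u n)) ` {1..})"
    using nonneg by (intro bdd_belowI[of _ 0]) auto
  have L0: "L \<ge> 0" unfolding L_def using nonneg by (intro cINF_greatest) auto
  have Lle: "L \<le> root n (u n)" if "n \<ge> 1" for n
    unfolding L_def using bdd that by (intro cINF_lower) auto
  have pow: "L ^ n \<le> u n" if "n \<ge> 1" for n
    using power_mono[OF Lle[OF that] L0, of n] nonneg[of n] that by simp
  have "(\<lambda>n. root n (u n)) \<longlonglongrightarrow> L"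
  proof (rule LIMSEQ_I)
    fix \<epsilon> :: real assume "\<epsilon> > 0"
    define c where "c = L + \<epsilon> / 2"
    have c: "c > 0" "L < c" "c < L + \<epsilon>" using \<open>\<epsilon> > 0\<close> L0 by (auto simp: c_def)
    obtain m where m: "m \<ge> 1" "root m (u m) < c"
      using cINF_less_iff[OF _ bdd, of c] c(2) unfolding L_def by auto
    have um: "u m \<le> c ^ m"
      using power_mono[of "root m (u m)" c m] m nonneg[of m] by simp
    \<comment> \<open>\<open>K\<close> absorbs the remainder of the exponent modulo
      \<open>m\<close>; its n-th root tends to 1.\<close>
    define K where "K = 1 + (\<Sum>s<m. u s / c ^ s)"
    have "K > 0" unfolding K_def using nonneg c by (intro add_pos_nonneg sum_nonneg) auto
    have q: "u (m * q + s) \<le> c ^ (m * q) * u s" for q s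
    proof (induction q)
      case (Suc q)
      have "u (m * Suc q + s) \<le> u m * u (m * q + s)"
        using sub[of m "m * q + s"] by (simp add: algebra_simps)
      also have "\<dots> \<le> c ^ m * (c ^ (m * q) * u s)"
        using um Suc nonneg c by (intro mult_mono) auto
      finally show ?case by (simp add: power_add algebra_simps)
    qed simp
    have bound: "u n \<le> K * c ^ n" for n
    proof -
      define s where "s = n mod m"
      have "s < m" using m by (simp add: s_def)
      have "u s / c ^ s \<le> (\<Sum>s<m. u s / c ^ s)"
        using \<open>s < m\<close> nonneg c by (intro member_le_sum) auto
      then have "u s / c ^ s \<le> K" by (simp add: K_def)
      then have us: "u s \<le> K * c ^ s" using c by (simp add: field_simps)
      have "u n \<le> c ^ (m * (n div m)) * u s"
        using q[of "n div m" s] by (simp add: s_def)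
      also have "\<dots> \<le> c ^ (m * (n div m)) * (K * c ^ s)"
        using us c by (intro mult_left_mono) auto
      also have "\<dots> = K * c ^ (m * (n div m) + s)" by (simp add: power_add)
      finally show ?thesis by (simp add: s_def)
    qed
    have "(\<lambda>n. root n K * c) \<longlonglongrightarrow> 1 * c"
      by (intro tendsto_intros LIMSEQ_root_const \<open>K > 0\<close>)
    then have "eventually (\<lambda>n. root n K * c < L + \<epsilon>) sequentially"
      using c(3) by (intro order_tendstoD) auto
    then obtain N where N: "\<And>n. n \<ge> N \<Longrightarrow> root n K * c < L + \<epsilon>"
      unfolding eventually_sequentially by blast
    have "norm (root n (u n) - L) < \<epsilon>" if "n \<ge> max N 1" for n
    proof -
      have "root n (u n) \<le> root n (K * c ^ n)" using bound that by simp
      also have "\<dots> = root n K * c" using that c by (simp add: real_root_mult real_root_power_cancel)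
      also have "\<dots> < L + \<epsilon>" using N that by simp
      finally show ?thesis using Lle[of n] that by simp
    qed
    then show "\<exists>N. \<forall>n\<ge>N. norm (root n (u n) - L) < \<epsilon>" by blast
  qed
  then show ?thesis using that L0 pow by blast
qed

section \<open>Algebra of product sets and bounds on operator norms\<close>

lemma product_set_0: "product_set S 0 = {mat 1}"
  unfolding product_set_def by auto

lemma product_set_Suc: "product_set S (Suc k) = {s ** w | s w. s \<in> S \<and> w \<in> product_set S k}"
proof (intro Set.set_eqI iffI)
  fix x assume "x \<in> product_set S (Suc k)"
  then obtain xs where xs: "x = foldr (**) xs (mat 1)" "length xs = Suc k" "set xs \<subseteq> S"
    unfolding product_set_def by blast
  then obtain s ys where "xs = s # ys" by (cases xs) auto
  then show "x \<in> {s ** w | s w. s \<in> S \<and> w \<in> product_set S k}"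
    using xs unfolding product_set_def by auto
next
  fix x assume "x \<in> {s ** w | s w. s \<in> S \<and> w \<in> product_set S k}"
  then obtain s ys where "s \<in> S" "x = s ** foldr (**) ys (mat 1)" "length ys = k" "set ys \<subseteq> S"
    unfolding product_set_def by blast
  then show "x \<in> product_set S (Suc k)"
    unfolding product_set_def by (intro CollectI exI[of _ "s # ys"]) auto
qed

lemma product_set_1: "product_set S 1 = S"
  using product_set_Suc[of S 0] by (simp add: product_set_0 matrix_mul_rid)

lemma product_set_add:
  "product_set S (m + n) = {a ** b | a b. a \<in> product_set S m \<and> b \<in> product_set S n}"
proof (induction m)
  case 0
  then show ?case by (simp add: product_set_0 matrix_mul_lid)
next
  case (Suc m)
  then show ?case
    unfolding add_Suc product_set_Suc by (auto; metis matrix_mul_assoc)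
qed

lemma product_set_mult: "product_set (product_set S q) k = product_set S (q * k)"
proof (induction k)
  case 0
  then show ?case by (simp add: product_set_0)
next
  case (Suc k)
  then show ?case
    by (simp add: product_set_Suc[of "product_set S q"] product_set_add)
qed

lemma sup_nonneg_upper:
  "bdd_above (f ` S) \<Longrightarrow> s \<in> S \<Longrightarrow> f s \<le> sup_nonneg f S"
  unfolding sup_nonneg_def by (auto intro: cSUP_upper)

lemma sup_nonneg_least:
  "(\<And>s. s \<in> S \<Longrightarrow> f s \<le> c) \<Longrightarrow> c \<ge> 0 \<Longrightarrow> sup_nonneg f S \<le> c"
  unfolding sup_nonneg_def by (auto intro: cSUP_least)

lemma sup_nonneg_ge_0:
  assumes "bdd_above (f ` S)" "\<And>s. s \<in> S \<Longrightarrow> f s \<ge> 0"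
  shows "sup_nonneg f S \<ge> 0"
proof (cases "S = {}")
  case False
  then obtain s where "s \<in> S" by blast
  then show ?thesis using sup_nonneg_upper[OF assms(1)] assms(2) by (meson order_trans)
qed (simp add: sup_nonneg_def)

lemma onorm_matrix_mult:
  fixes a b :: "complex^'n^'n"
  shows "onorm ((*v) (a ** b)) \<le> onorm ((*v) a) * onorm ((*v) b)"
proof -
  have "(*v) (a ** b) = (*v) a \<circ> (*v) b"
    by (auto simp: fun_eq_iff matrix_vector_mul_assoc)
  then show ?thesis using onorm_compose[of "(*v) a" "(*v) b"] by simp
qed

lemma norm_matrix_vector_le:
  fixes a :: "complex^'n^'n"
  shows "norm (a *v x) \<le> real CARD('n) ^ 2 * norm a * norm x"
proof -
  have "norm (a *v x) \<le> (\<Sum>i\<in>UNIV. norm ((a *v x) $ i))" 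
    unfolding norm_vec_def[of "a *v x"] by (rule L2_set_le_sum) simp
  also have "\<dots> \<le> (\<Sum>i\<in>(UNIV::'n set). \<Sum>j\<in>(UNIV::'n set). norm a * norm x)"
  proof (intro sum_mono)
    fix i
    have "norm (a $ i $ j * x $ j) \<le> norm a * norm x" for j
      unfolding norm_mult
      by (intro mult_mono order_trans[OF Finite_Cartesian_Product.norm_nth_le Finite_Cartesian_Product.norm_nth_le]
        Finite_Cartesian_Product.norm_nth_le) auto
    then show "norm ((a *v x) $ i) \<le> (\<Sum>j\<in>(UNIV::'n set). norm a * norm x)"
      unfolding matrix_vector_mult_def by (simp add: sum_norm_le del: sum_constant)
  qed
  also have "\<dots> = real CARD('n) ^ 2 * norm a * norm x" by (simp add: power2_eq_square)
  finally show ?thesis .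
qed

lemma bdd_above_onorm:
  fixes S :: "(complex^'n^'n) set"
  assumes "bounded S"
  shows "bdd_above ((\<lambda>s. onorm ((*v) s)) ` S)"
proof -
  obtain B where B: "\<And>s. s \<in> S \<Longrightarrow> norm s \<le> B" using assms unfolding bounded_iff by blast
  have "onorm ((*v) s) \<le> real CARD('n) ^ 2 * B" if "s \<in> S" for s
  proof (rule onorm_le)
    fix x
    have "norm (s *v x) \<le> real CARD('n) ^ 2 * norm s * norm x" by (rule norm_matrix_vector_le)
    also have "\<dots> \<le> real CARD('n) ^ 2 * B * norm x"
      using B[OF that] by (intro mult_right_mono mult_left_mono) auto
    finally show "norm (s *v x) \<le> real CARD('n) ^ 2 * B * norm x" .
  qed
  then show ?thesis by (intro bdd_aboveI2) auto
qed

lemma bdd_above_onorm_product_set: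
  fixes S :: "(complex^'n^'n) set"
  assumes "bdd_above ((\<lambda>s. onorm ((*v) s)) ` S)"
  shows "bdd_above ((\<lambda>s. onorm ((*v) s)) ` product_set S k)"
proof -
  obtain B where B: "\<And>s. s \<in> S \<Longrightarrow> onorm ((*v) s) \<le> B" using assms unfolding bdd_above_def by auto
  \<comment> \<open>\<open>B\<close> may be negative when \<open>S\<close> is empty.\<close>
  define C where "C = max B 0"
  have C: "C \<ge> 0" "\<And>s. s \<in> S \<Longrightarrow> onorm ((*v) s) \<le> C" using B by (auto simp: C_def le_max_iff_disj)
  have "\<forall>w\<in>product_set S k. onorm ((*v) w) \<le> C ^ k"
  proof (induction k)
    case 0
    have "onorm ((*v) (mat 1 :: complex^'n^'n)) \<le> 1" by (rule onorm_le) (simp add: matrix_vector_mul_lid)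
    then show ?case by (simp add: product_set_0 del: matrix_vector_mul_lid)
  next
    case (Suc k)
    have "onorm ((*v) (s ** w)) \<le> C ^ Suc k" if "s \<in> S" "w \<in> product_set S k" for s w
    proof -
      have "onorm ((*v) s) * onorm ((*v) w) \<le> C * C ^ k"
        using that Suc C by (intro mult_mono onorm_pos_le) auto
      then show ?thesis using onorm_matrix_mult[of s w] by simp
    qed
    then show ?case by (auto simp: product_set_Suc)
  qed
  then show ?thesis by (intro bdd_aboveI2) auto
qed

text \<open>Submultiplicativity of the operator norm on product sets makes Fekete's lemma
  applicable, so the \<open>lim\<close> in the definition is a genuine limit and lies below every
  root of positive index.\<close>

lemma joint_spectral_radius_power_le:
  fixes S :: "(complex^'n^'n) set"
  assumes "bounded S"
  shows "joint_spectral_radius S \<ge> 0"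
    and "n \<ge> 1 \<Longrightarrow> joint_spectral_radius S ^ n \<le> set_opnorm (product_set S n)"
proof -
  let ?u = "\<lambda>n. set_opnorm (product_set S n)"
  have bdd: "bdd_above ((\<lambda>s. onorm ((*v) s)) ` product_set S k)" for k
    by (intro bdd_above_onorm_product_set bdd_above_onorm assms)
  have nonneg: "?u n \<ge> 0" for n
    unfolding set_opnorm_def by (intro sup_nonneg_ge_0 bdd onorm_pos_le) auto
  have "?u (m + n) \<le> ?u m * ?u n" for m n
    unfolding set_opnorm_def[of "product_set S (m + n)"]
  proof (rule sup_nonneg_least)
    fix w assume "w \<in> product_set S (m + n)"
    then obtain a b where ab: "w = a ** b" "a \<in> product_set S m" "b \<in> product_set S n"
      unfolding product_set_add by blast
    have "onorm ((*v) a) * onorm ((*v) b) \<le> ?u m * ?u n"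
      using ab nonneg unfolding set_opnorm_def by (intro mult_mono sup_nonneg_upper bdd onorm_pos_le) 
        (auto simp flip: set_opnorm_def)
    then show "onorm ((*v) w) \<le> ?u m * ?u n" using ab onorm_matrix_mult[of a b] by simp
  qed (use nonneg in simp)
  from submultiplicative_root_limit[of ?u, OF nonneg this]
  obtain L where L: "(\<lambda>n. root n (?u n)) \<longlonglongrightarrow> L" "L \<ge> 0" "\<And>n. n \<ge> 1 \<Longrightarrow> L ^ n \<le> ?u n" by blast
  then have "joint_spectral_radius S = L"
    unfolding joint_spectral_radius_def by (simp add: limI)
  then show "joint_spectral_radius S \<ge> 0" "n \<ge> 1 \<Longrightarrow> joint_spectral_radius S ^ n \<le> ?u n"
    using L by auto
qed

section \<open>Eigenvalue moduli, traces and operator norms\<close>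

lemma finite_eigenvalue_moduli:
  fixes A :: "complex^'n^'n"
  shows "finite {cmod c | c. matrix_eigenvalue A c}" "{cmod c | c. matrix_eigenvalue A c} \<noteq> {}"
proof -
  obtain es where es: "length es = CARD('n)" "\<And>c. matrix_eigenvalue A c \<longleftrightarrow> c \<in> set es"
    using complex_matrix_eigenvalue_list[of A] by metis
  have "{cmod c | c. matrix_eigenvalue A c} = cmod ` set es" using es(2) by auto
  moreover have "set es \<noteq> {}" using es(1) by auto
  ultimately show "finite {cmod c | c. matrix_eigenvalue A c}" "{cmod c | c. matrix_eigenvalue A c} \<noteq> {}"
    by auto
qed

text \<open>The trace adds up \<open>CARD('n)\<close> eigenvalues, counted with multiplicity; an
  eigenvector for \<open>c\<close> is stretched by exactly \<open>cmod c\<close>.\<close>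

lemma max_eigenvalue_modulus_bounds:
  fixes A :: "complex^'n^'n"
  shows "cmod (trace A) \<le> real CARD('n) * max_eigenvalue_modulus A"
    and "max_eigenvalue_modulus A \<ge> 0"
    and "max_eigenvalue_modulus A \<le> onorm ((*v) A)"
proof -
  obtain es where es: "length es = CARD('n)" "\<And>m. trace (((**) A ^^ m) (mat 1)) = (\<Sum>x\<leftarrow>es. x ^ m)"
    "\<And>c. matrix_eigenvalue A c \<longleftrightarrow> c \<in> set es"
    using complex_matrix_eigenvalue_list[of A] by metis
  have le: "cmod c \<le> max_eigenvalue_modulus A" if "c \<in> set es" for c
    unfolding max_eigenvalue_modulus_def using that es(3) finite_eigenvalue_moduli(1)[of A]
    by (intro Max_ge) auto
  have "trace A = (\<Sum>x\<leftarrow>es. x)" using es(2)[of 1] by (simp add: matrix_mul_rid)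
  moreover have "cmod (\<Sum>x\<leftarrow>es. x) \<le> real (length es) * max_eigenvalue_modulus A"
    using le
  proof (induction es)
    case (Cons x es)
    have "cmod (x + (\<Sum>x\<leftarrow>es. x)) \<le> cmod x + cmod (\<Sum>x\<leftarrow>es. x)" by (rule norm_triangle_ineq)
    also have "\<dots> \<le> max_eigenvalue_modulus A + real (length es) * max_eigenvalue_modulus A"
      using Cons by (intro add_mono) auto
    finally show ?case by (simp add: algebra_simps)
  qed simp
  ultimately show "cmod (trace A) \<le> real CARD('n) * max_eigenvalue_modulus A"
    using es(1) by simp
  have "es \<noteq> []" using es(1) by auto
  then show "max_eigenvalue_modulus A \<ge> 0"
    using le[of "hd es"] norm_ge_zero[of "hd es"] by (meson hd_in_set order_trans)
  have "cmod c \<le> onorm ((*v) A)" if "matrix_eigenvalue A c" for c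
  proof -
    obtain v where v: "v \<noteq> 0" "A *v v = c *s v" using \<open>matrix_eigenvalue A c\<close> unfolding matrix_eigenvalue_def by blast
    have "norm (c *s v) = cmod c * norm v"
      by (simp add: norm_vec_def norm_mult L2_set_right_distrib)
    moreover have "norm (A *v v) \<le> onorm ((*v) A) * norm v" by (rule onorm) simp
    ultimately show ?thesis using v by simp
  qed
  then show "max_eigenvalue_modulus A \<le> onorm ((*v) A)"
    unfolding max_eigenvalue_modulus_def using finite_eigenvalue_moduli[of A] by (subst Max_le_iff) auto
qed

text \<open>Operator norms dominate eigenvalue moduli and are bounded on the product set, so the
  supremum is taken over a set that is bounded above.\<close>

lemma set_eigenvalue_modulus_product_set:
  fixes S :: "(complex^'n^'n) set"
  assumes "bounded S"
  shows "set_eigenvalue_modulus (product_set S k) \<ge> 0"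
    and "w \<in> product_set S k \<Longrightarrow> max_eigenvalue_modulus w \<le> set_eigenvalue_modulus (product_set S k)"
proof -
  obtain B where "\<And>w. w \<in> product_set S k \<Longrightarrow> onorm ((*v) w) \<le> B"
    using bdd_above_onorm_product_set[OF bdd_above_onorm[OF assms], of k] unfolding bdd_above_def by auto
  then have bdd: "bdd_above (max_eigenvalue_modulus ` product_set S k)"
    by (intro bdd_aboveI2[where M = B]) (meson max_eigenvalue_modulus_bounds(3) order_trans)
  show "set_eigenvalue_modulus (product_set S k) \<ge> 0"
    unfolding set_eigenvalue_modulus_def using bdd max_eigenvalue_modulus_bounds(2) by (intro sup_nonneg_ge_0)
  show "w \<in> product_set S k \<Longrightarrow> max_eigenvalue_modulus w \<le> set_eigenvalue_modulus (product_set S k)"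
    unfolding set_eigenvalue_modulus_def using bdd by (intro sup_nonneg_upper)
qed

section \<open>Block matrices with an approximate fixed vector\<close>

text \<open>An index is a pair of a block number and a coordinate inside the block.\<close>

definition matrix_block :: "'n::finite \<Rightarrow> 'n \<Rightarrow> complex^('n \<times> 'n)^('n \<times> 'n) \<Rightarrow> complex^'n^'n" where
  "matrix_block i j M = (\<chi> a b. M $ (i,a) $ (j,b))"

text \<open>Applied to stacked vectors e_j, block row \<open>i\<close> produces \<open>t i\<close>
  of the combination of the e_j with coefficients \<open>c i j\<close>; hence one matrix per
  row.\<close>

definition block_matrix :: "('n::finite \<Rightarrow> 'n \<Rightarrow> complex) \<Rightarrow> ('n \<Rightarrow> complex^'n^'n) \<Rightarrow> complex^('n \<times> 'n)^('n \<times> 'n)" where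
  "block_matrix c t = (\<chi> p q. c (fst p) (fst q) * t (fst p) $ snd p $ snd q)"

lemma sum_UNIV_prod:
  fixes f :: "'a::finite \<times> 'b::finite \<Rightarrow> 'c::comm_monoid_add"
  shows "(\<Sum>p\<in>UNIV. f p) = (\<Sum>i\<in>UNIV. \<Sum>j\<in>UNIV. f (i, j))"
  unfolding UNIV_Times_UNIV[symmetric] sum.cartesian_product by simp

lemma matrix_block_mult:
  "matrix_block i j (block_matrix c t ** M) $ a $ b = (\<Sum>l\<in>UNIV. c i l * (t i ** matrix_block l j M) $ a $ b)"
  by (simp add: matrix_block_def block_matrix_def matrix_matrix_mult_def sum_UNIV_prod sum_distrib_left mult.assoc)

text \<open>One step in expanding a power of the block matrix: \<open>t i\<close> moves into
  \<open>G\<close>, so iteration collects products of the matrices \<open>t i\<close>.\<close>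

lemma trace_block_matrix_mult:
  "trace (G ** matrix_block i j (block_matrix c t ** M)) =
     (\<Sum>l\<in>UNIV. c i l * trace ((G ** t i) ** matrix_block l j M))"
proof -
  have tr: "trace (G ** X) = (\<Sum>a\<in>UNIV. \<Sum>b\<in>UNIV. G $ a $ b * X $ b $ a)" for G X :: "complex^'n^'n"
    by (simp add: trace_def matrix_matrix_mult_def)
  have "trace (G ** matrix_block i j (block_matrix c t ** M)) =
      (\<Sum>a\<in>UNIV. \<Sum>b\<in>UNIV. \<Sum>l\<in>UNIV. c i l * (G $ a $ b * (t i ** matrix_block l j M) $ b $ a))"
    unfolding tr matrix_block_mult by (simp add: sum_distrib_left mult.left_commute)
  also have "\<dots> = (\<Sum>a\<in>UNIV. \<Sum>l\<in>UNIV. \<Sum>b\<in>UNIV. c i l * (G $ a $ b * (t i ** matrix_block l j M) $ b $ a))"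
    by (intro sum.cong refl sum.swap)
  also have "\<dots> = (\<Sum>l\<in>UNIV. \<Sum>a\<in>UNIV. \<Sum>b\<in>UNIV. c i l * (G $ a $ b * (t i ** matrix_block l j M) $ b $ a))"
    by (rule sum.swap)
  also have "\<dots> = (\<Sum>l\<in>UNIV. c i l * trace (G ** (t i ** matrix_block l j M)))"
    unfolding tr by (simp add: sum_distrib_left)
  finally show ?thesis by (simp add: matrix_mul_assoc)
qed

text \<open>Peeling off \<open>k\<close> factors leaves \<open>CARD('n) ^ k\<close> terms with
  coefficients of modulus at most \<open>\<gamma> ^ k\<close>. The induction varies
  \<open>G\<close>, which absorbs the peeled factors.\<close>

lemma trace_block_power_le:
  fixes t :: "'n::finite \<Rightarrow> complex^'n^'n"
  assumes t: "\<And>i. t i \<in> T" and c: "\<And>i j. cmod (c i j) \<le> \<gamma>"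
    and "\<And>u. u \<in> product_set T k \<Longrightarrow> cmod (trace (G ** u)) \<le> \<beta>"
  shows "cmod (trace (G ** matrix_block i j (((**) (block_matrix c t) ^^ k) (mat 1)))) \<le> \<beta> * (real CARD('n) * \<gamma>) ^ k"
  using assms(3)
proof (induction k arbitrary: G i)
  case 0
  have one: "cmod (trace (G ** mat 1)) \<le> \<beta>" using 0 by (simp add: product_set_0 del: matrix_mul_rid)
  \<comment> \<open>Off-diagonal blocks contribute 0, which is at most \<open>\<beta>\<close>
    because \<open>\<beta>\<close> bounds a modulus.\<close>
  have "matrix_block i j (mat 1) = (if i = j then mat 1 else 0)"
    by (auto simp: matrix_block_def Finite_Cartesian_Product.mat_def Finite_Cartesian_Product.vec_eq_iff)
  moreover have "trace (G ** 0) = 0" by (simp add: trace_def matrix_matrix_mult_def)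
  ultimately show ?case using one order_trans[OF norm_ge_zero one] by simp
next
  case (Suc k)
  let ?M = "((**) (block_matrix c t) ^^ k) (mat 1)"
  have "cmod (trace (G ** t i ** matrix_block l j ?M)) \<le> \<beta> * (real CARD('n) * \<gamma>) ^ k" for l
  proof (rule Suc.IH)
    fix u assume "u \<in> product_set T k"
    then have "t i ** u \<in> product_set T (Suc k)" using t by (auto simp: product_set_Suc)
    then show "cmod (trace (G ** t i ** u)) \<le> \<beta>" using Suc.prems by (metis matrix_mul_assoc)
  qed
  then have "cmod (c i l * trace (G ** t i ** matrix_block l j ?M)) \<le> \<gamma> * (\<beta> * (real CARD('n) * \<gamma>) ^ k)" for l
    unfolding norm_mult using c by (intro mult_mono) (auto intro: order_trans[OF norm_ge_zero])
  then have "cmod (\<Sum>l\<in>UNIV. c i l * trace (G ** t i ** matrix_block l j ?M)) 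
      \<le> (\<Sum>l\<in>(UNIV::'n set). \<gamma> * (\<beta> * (real CARD('n) * \<gamma>) ^ k))"
    by (intro sum_norm_le)
  then show ?case by (simp add: trace_block_matrix_mult algebra_simps)
qed

text \<open>One factor \<open>CARD('n)\<close> counts the diagonal blocks, the other comes from
  bounding a trace by the largest eigenvalue modulus.\<close>

lemma trace_block_matrix_power_le:
  fixes t :: "'n::finite \<Rightarrow> complex^'n^'n"
  assumes "bounded T" and t: "\<And>i. t i \<in> T" and c: "\<And>i j. cmod (c i j) \<le> \<gamma>"
  shows "cmod (trace (((**) (block_matrix c t) ^^ k) (mat 1)))
    \<le> real CARD('n) ^ 2 * (set_eigenvalue_modulus (product_set T k) * (real CARD('n) * \<gamma>) ^ k)"
proof -
  let ?M = "((**) (block_matrix c t) ^^ k) (mat 1)"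
  let ?\<beta> = "real CARD('n) * set_eigenvalue_modulus (product_set T k)"
  have "trace ?M = (\<Sum>i\<in>UNIV. trace (mat 1 ** matrix_block i i ?M))"
    by (simp add: trace_def matrix_block_def sum_UNIV_prod)
  also have "cmod \<dots> \<le> (\<Sum>i\<in>(UNIV::'n set). ?\<beta> * (real CARD('n) * \<gamma>) ^ k)"
  proof (intro sum_norm_le trace_block_power_le[OF t c])
    fix u assume "u \<in> product_set T k"
    then have "real CARD('n) * max_eigenvalue_modulus u \<le> ?\<beta>"
      using set_eigenvalue_modulus_product_set(2)[OF assms(1)] by (intro mult_left_mono) auto
    with max_eigenvalue_modulus_bounds(1)[of u] have "cmod (trace u) \<le> ?\<beta>" by (rule order_trans)
    then show "cmod (trace (mat 1 ** u)) \<le> ?\<beta>" by (simp add: matrix_mul_lid)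
  qed
  finally show ?thesis by (simp add: power2_eq_square algebra_simps)
qed

section \<open>Near-maximal determinants and approximate eigenvectors\<close>

lemma complex_matrix_vector_mult_scaleR:
  fixes A :: "complex^'n^'m"
  shows "A *v (c *\<^sub>R x) = c *\<^sub>R (A *v x)"
  by (simp add: Finite_Cartesian_Product.vec_eq_iff matrix_vector_mult_def scaleR_sum_right)

text \<open>Replacing a column of \<open>A\<close> by \<open>y\<close> keeps all columns in
  \<open>X\<close>, so the determinant grows by a factor of at most 2, and Cramer's rule turns this
  into the coordinate bound. The unit vectors make the supremum at least 1, hence \<open>A\<close>
  invertible. Settling for half the supremum avoids any compactness of \<open>X\<close>.\<close>

lemma near_auerbach_basis:
  fixes X :: "(complex^'n) set"
  assumes "bounded X" and axes: "\<And>j. axis j 1 \<in> X"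
  obtains A :: "complex^'n^'n" where "\<And>j. column j A \<in> X"
    and "\<And>y. y \<in> X \<Longrightarrow> \<exists>a. A *v a = y \<and> (\<forall>j. cmod (a $ j) \<le> 2)"
proof -
  obtain K where K: "\<And>x. x \<in> X \<Longrightarrow> norm x \<le> K" using \<open>bounded X\<close> unfolding bounded_iff by blast
  define \<D> where "\<D> = {A :: complex^'n^'n. \<forall>j. column j A \<in> X}"
  have one: "mat 1 \<in> \<D>"
  proof -
    have "column j (mat 1 :: complex^'n^'n) = axis j 1" for j :: 'n
      by (auto simp: column_def axis_def Finite_Cartesian_Product.mat_def Finite_Cartesian_Product.vec_eq_iff)
    then show ?thesis using axes by (simp add: \<D>_def)
  qed
  have bdd: "bdd_above ((\<lambda>A. cmod (det A)) ` \<D>)"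
  proof (rule bdd_aboveI2)
    fix A assume A: "A \<in> \<D>"
    have entry: "cmod (A $ i $ j) \<le> K" for i j
      using Finite_Cartesian_Product.norm_nth_le[of "column j A" i] K[of "column j A"] A by (simp add: \<D>_def column_def)
    show "cmod (det A) \<le> (\<Sum>p\<in>{p. p permutes (UNIV :: 'n set)}. K ^ CARD('n))"
      unfolding Determinants.det_def
    proof (rule sum_norm_le)
      fix p :: "'n \<Rightarrow> 'n"
      have "cmod (\<Prod>i\<in>UNIV. A $ i $ p i) \<le> (\<Prod>i\<in>(UNIV::'n set). K)"
        unfolding prod_norm[symmetric] by (intro prod_mono) (use entry in auto)
      then show "cmod (of_int (sign p) * (\<Prod>i\<in>UNIV. A $ i $ p i)) \<le> K ^ CARD('n)"
        by (auto simp: norm_mult sign_def)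
    qed
  qed
  define s where "s = (SUP A\<in>\<D>. cmod (det A))"
  have "1 \<le> s" unfolding s_def using cSUP_upper[OF one bdd] by simp
  then have "s / 2 < (SUP A\<in>\<D>. cmod (det A))" by (simp flip: s_def)
  then obtain A where A: "A \<in> \<D>" "s / 2 < cmod (det A)"
    using less_cSUP_iff[OF _ bdd] one by blast
  have det: "det A \<noteq> 0" using A(2) \<open>1 \<le> s\<close> by auto
  have "\<exists>a. A *v a = y \<and> (\<forall>j. cmod (a $ j) \<le> 2)" if "y \<in> X" for y
  proof -
    define R where "R = (\<lambda>k. \<chi> i j. if j = k then y $ i else A $ i $ j)"
    define a where "a = (\<chi> k. det (R k) / det A)"
    have "A *v a = y" using cramer[OF det, of a y] by (simp add: a_def R_def)
    moreover have "cmod (a $ k) \<le> 2" for k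
    proof -
      have "column j (R k) = (if j = k then y else column j A)" for j
        by (auto simp: column_def R_def Finite_Cartesian_Product.vec_eq_iff)
      then have "R k \<in> \<D>" using A(1) that by (simp add: \<D>_def)
      then have "cmod (det (R k)) \<le> s" unfolding s_def by (rule cSUP_upper[OF _ bdd])
      also have "s \<le> 2 * cmod (det A)" using A(2) by simp
      finally show ?thesis using det by (simp add: a_def norm_divide field_simps)
    qed
    ultimately show ?thesis by blast
  qed
  then show ?thesis using that[of A] A(1) by (simp add: \<D>_def)
qed

text \<open>\<open>E\<close> stacks the basis vectors, and the block matrix reproduces each of them
  up to an error of norm 1. It must be large: by \<open>growth\<close> the norms on \<open>X\<close>
  have supremum at least \<open>N + 1\<close>, while the points of \<open>X\<close> are combinations
  of the basis with coefficients of modulus at most 2.\<close>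

lemma exists_approximate_block_eigenvector:
  fixes T :: "(complex^'n^'n) set"
  assumes "bounded T" "T \<noteq> {}" "r > 0"
    and growth: "r ^ N \<le> set_opnorm (product_set T N)"
  obtains c t E where "\<And>i. t i \<in> T" "\<And>i j. cmod (c i j) \<le> 4 / r"
    "real N + 1 \<le> 2 * real CARD('n) ^ 2 * norm E"
    "norm (block_matrix c t *v E - E) \<le> real CARD('n) ^ 2"
proof -
  \<comment> \<open>The factor \<open>n + 1\<close> forces the sizes of the bodies \<open>X\<close> to tend to infinity with \<open>N\<close>, while
    consecutive weights have ratio at most \<open>2 / r\<close>.\<close>
  define b where "b = (\<lambda>n. (real n + 1) / r ^ n)"
  have b_pos: "b n > 0" for n using \<open>r > 0\<close> by (simp add: b_def add_pos_nonneg)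
  define X where "X = {b n *\<^sub>R (w *v x) | n w x. n \<le> N \<and> w \<in> product_set T n \<and> norm x \<le> 1}"
  have "bounded X"
  proof -
    have "\<exists>B\<ge>0. \<forall>w\<in>product_set T n. onorm ((*v) w) \<le> B" for n
    proof -
      obtain B where "\<And>w. w \<in> product_set T n \<Longrightarrow> onorm ((*v) w) \<le> B"
        using bdd_above_onorm_product_set[OF bdd_above_onorm[OF \<open>bounded T\<close>], of n] unfolding bdd_above_def by auto
      then show ?thesis by (intro exI[of _ "max 0 B"]) (auto simp: le_max_iff_disj)
    qed
    then obtain B where B: "\<And>n. B n \<ge> 0" "\<And>n w. w \<in> product_set T n \<Longrightarrow> onorm ((*v) w) \<le> B n" by metis
    have "norm (b n *\<^sub>R (w *v x)) \<le> (\<Sum>n\<le>N. b n * B n)"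
      if "n \<le> N" "w \<in> product_set T n" "norm x \<le> 1" for n w x
    proof -
      have "norm (w *v x) \<le> onorm ((*v) w) * norm x" by (rule onorm) simp
      also have "\<dots> \<le> B n * 1" using that B by (intro mult_mono) auto
      finally have "norm (b n *\<^sub>R (w *v x)) \<le> b n * B n" using b_pos[of n] by simp
      also have "\<dots> \<le> (\<Sum>n\<le>N. b n * B n)"
        using that B b_pos by (intro member_le_sum) (auto simp: less_imp_le)
      finally show ?thesis .
    qed
    then show ?thesis unfolding bounded_iff X_def by blast
  qed
  \<comment> \<open>Since \<open>b 0 = 1\<close>, the empty product puts the unit ball into
    \<open>X\<close>.\<close>
  moreover have "axis j 1 \<in> X" for j
    unfolding X_def by (intro CollectI exI[of _ 0] exI[of _ "mat 1"] exI[of _ "axis j 1"])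
      (simp add: b_def product_set_0)
  ultimately obtain A :: "complex^'n^'n" where col: "\<And>j. column j A \<in> X"
    and coord: "\<And>y. y \<in> X \<Longrightarrow> \<exists>a. A *v a = y \<and> (\<forall>j. cmod (a $ j) \<le> 2)"
    using near_auerbach_basis[of X] by blast
  have "\<exists>s a. s \<in> T \<and> (\<forall>j. cmod (a $ j) \<le> 4 / r) \<and> norm (s *v (A *v a) - column i A) \<le> 1" for i
  proof -
    obtain n w x where n: "n \<le> N" "w \<in> product_set T n" "norm x \<le> 1" "column i A = b n *\<^sub>R (w *v x)"
      using col[of i] unfolding X_def by blast
    show ?thesis
    proof (cases n)
      \<comment> \<open>A column in the unit ball is treated entirely as error term.\<close>
      case 0
      then have "column i A = x" using n by (simp add: b_def product_set_0)
      moreover obtain s where "s \<in> T" using \<open>T \<noteq> {}\<close> by blast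
      ultimately show ?thesis using n \<open>r > 0\<close> by (intro exI[of _ s] exI[of _ 0]) simp
    next
      case (Suc m)
      then obtain s v where sv: "w = s ** v" "s \<in> T" "v \<in> product_set T m"
        using n(2) by (auto simp: product_set_Suc)
      \<comment> \<open>Dropping the first factor \<open>s\<close> leaves a point of
        \<open>X\<close>, whose coordinates are controlled; the ratio \<open>q\<close> then restores
        the weight.\<close>
      have "b m *\<^sub>R (v *v x) \<in> X" unfolding X_def using n(1,3) Suc sv(3) by (intro CollectI exI[of _ m] exI[of _ v] exI[of _ x]) auto
      then obtain a where a: "A *v a = b m *\<^sub>R (v *v x)" "\<And>j. cmod (a $ j) \<le> 2" using coord by blast
      define q where "q = b n / b m"
      have q: "0 \<le> q" "q \<le> 2 / r"
      proof -
        have ratio: "q = (real m + 2) / (real m + 1) * (1 / r)"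
          using \<open>r > 0\<close> by (simp add: q_def b_def Suc add.commute)
        have "(real m + 2) / (real m + 1) \<le> 2" by (simp add: field_simps)
        then have "q \<le> 2 * (1 / r)"
          unfolding ratio using \<open>r > 0\<close> by (intro mult_right_mono) auto
        then show "q \<le> 2 / r" by simp
      qed (use b_pos[of n] b_pos[of m] in \<open>simp add: q_def\<close>)
      have "s *v (A *v (q *\<^sub>R a)) = q *\<^sub>R (b m *\<^sub>R (s *v (v *v x)))"
        by (simp add: complex_matrix_vector_mult_scaleR a(1))
      also have "\<dots> = column i A"
        using b_pos[of m] by (simp add: n(4) sv(1) q_def matrix_vector_mul_assoc)
      finally have "norm (s *v (A *v (q *\<^sub>R a)) - column i A) \<le> 1" by simp
      \<comment> \<open>Weight ratio \<open>2 / r\<close> times coordinate bound 2.\<close>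
      moreover have "cmod ((q *\<^sub>R a) $ j) \<le> 4 / r" for j
        using mult_mono[OF q(2) a(2)[of j]] q \<open>r > 0\<close> by simp
      ultimately show ?thesis using sv(2) by blast
    qed
  qed
  then obtain t a where t: "\<And>i. t i \<in> T" and a: "\<And>i j. cmod (a i $ j) \<le> 4 / r"
    and res: "\<And>i. norm (t i *v (A *v a i) - column i A) \<le> 1" by metis
  define c where "c = (\<lambda>i j. a i $ j)"
  \<comment> \<open>Index \<open>(i, k)\<close> addresses entry \<open>k\<close> of basis vector
    \<open>i\<close>, hence the transposition.\<close>
  define E :: "complex^('n \<times> 'n)" where "E = (\<chi> p. A $ snd p $ fst p)"
  have WE: "(block_matrix c t *v E - E) $ (i, k) = (t i *v (A *v a i) - column i A) $ k" for i k
  proof -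
    have "(block_matrix c t *v E) $ (i, k) = (\<Sum>j\<in>UNIV. \<Sum>l\<in>UNIV. t i $ k $ l * (A $ l $ j * a i $ j))"
      by (simp add: matrix_vector_mult_def block_matrix_def E_def sum_UNIV_prod c_def mult_ac)
    also have "\<dots> = (t i *v (A *v a i)) $ k"
      by (subst sum.swap) (simp add: matrix_vector_mult_def sum_distrib_left)
    finally show ?thesis by (simp add: E_def column_def)
  qed
  have "norm (block_matrix c t *v E - E) \<le> (\<Sum>p\<in>UNIV. norm ((block_matrix c t *v E - E) $ p))"
    unfolding norm_vec_def[of "block_matrix c t *v E - E"] by (rule L2_set_le_sum) simp
  also have "\<dots> \<le> (\<Sum>p\<in>(UNIV :: ('n \<times> 'n) set). 1)"
  proof (rule sum_mono)
    fix p :: "'n \<times> 'n"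
    show "norm ((block_matrix c t *v E - E) $ p) \<le> 1"
      using order_trans[OF Finite_Cartesian_Product.norm_nth_le res[of "fst p"]] WE[of "fst p" "snd p"] by simp
  qed
  finally have err: "norm (block_matrix c t *v E - E) \<le> real CARD('n) ^ 2" by (simp add: power2_eq_square)
  \<comment> \<open>The 2 bounds the coordinates; the square counts the entries of a vector and the
    terms of each entry.\<close>
  define \<kappa> where "\<kappa> = 2 * real CARD('n) ^ 2 * norm E"
  have \<kappa>: "norm y \<le> \<kappa>" if y: "y \<in> X" for y
  proof -
    obtain a where a: "A *v a = y" "\<And>j. cmod (a $ j) \<le> 2" using coord[OF y] by blast
    have "norm y \<le> (\<Sum>i\<in>UNIV. cmod (y $ i))"
      unfolding norm_vec_def[of y] by (rule L2_set_le_sum) simp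
    also have "\<dots> \<le> (\<Sum>i\<in>(UNIV::'n set). \<Sum>j\<in>(UNIV::'n set). norm E * 2)"
    proof (rule sum_mono)
      fix i
      have "cmod (A $ i $ j * a $ j) \<le> norm E * 2" for j
        using Finite_Cartesian_Product.norm_nth_le[of E "(j, i)"] a(2)[of j]
        unfolding norm_mult by (intro mult_mono) (auto simp: E_def)
      then show "cmod (y $ i) \<le> (\<Sum>j\<in>(UNIV::'n set). norm E * 2)"
        unfolding a(1)[symmetric] matrix_vector_mult_def by (simp add: sum_norm_le del: sum_constant)
    qed
    also have "\<dots> = \<kappa>" by (simp add: \<kappa>_def power2_eq_square)
    finally show ?thesis .
  qed
  have "\<kappa> \<ge> 0" by (simp add: \<kappa>_def)
  \<comment> \<open>Unit vectors \<open>x\<close> give points \<open>b N *\<^sub>R (w *v x)\<close>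
    of \<open>X\<close>. Comparison with \<open>growth\<close> cancels \<open>r ^ N\<close> and
    leaves the factor \<open>N + 1\<close> of the weight.\<close>
  have "set_opnorm (product_set T N) \<le> \<kappa> / b N"
    unfolding set_opnorm_def
  proof (rule sup_nonneg_least)
    fix w assume w: "w \<in> product_set T N"
    show "onorm ((*v) w) \<le> \<kappa> / b N"
    proof (rule onorm_le)
      fix x
      show "norm (w *v x) \<le> \<kappa> / b N * norm x"
      proof (cases "x = 0")
        case False
        have "b N *\<^sub>R (w *v (x /\<^sub>R norm x)) \<in> X" unfolding X_def using w False by (intro CollectI exI conjI) auto
        from \<kappa>[OF this] show ?thesis
          using False b_pos[of N] by (simp add: complex_matrix_vector_mult_scaleR field_simps)
      qed simp
    qed
  qed (use \<open>\<kappa> \<ge> 0\<close> b_pos[of N] in simp)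
  with growth have "r ^ N \<le> \<kappa> / b N" by simp
  then have "(real N + 1) * r ^ N \<le> \<kappa> * r ^ N"
    using \<open>r > 0\<close> by (simp add: b_def field_simps)
  then have "real N + 1 \<le> \<kappa>" using \<open>r > 0\<close> by simp
  then show ?thesis using that[of t c E] t a err by (simp add: c_def \<kappa>_def)
qed

section \<open>Passage to a limit of the block matrices\<close>

lemma tendsto_matrix_mult:
  fixes X Y :: "'a \<Rightarrow> complex^'k::finite^'k"
  assumes "(X \<longlongrightarrow> A) F" "(Y \<longlongrightarrow> B) F"
  shows "((\<lambda>n. X n ** Y n) \<longlongrightarrow> A ** B) F"
  unfolding matrix_matrix_mult_def by (intro tendsto_intros assms)

lemma tendsto_matrix_vector_mult:
  fixes X :: "'a \<Rightarrow> complex^'k::finite^'k"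
  assumes "(X \<longlongrightarrow> A) F" "(v \<longlongrightarrow> u) F"
  shows "((\<lambda>n. X n *v v n) \<longlongrightarrow> A *v u) F"
  unfolding matrix_vector_mult_def by (intro tendsto_intros assms)

lemma norm_le_of_entries:
  fixes W :: "complex^'k::finite^'k"
  assumes "\<And>p q. cmod (W $ p $ q) \<le> M"
  shows "norm W \<le> real CARD('k) ^ 2 * M"
proof -
  have "norm W \<le> (\<Sum>p\<in>UNIV. norm (W $ p))"
    unfolding norm_vec_def[of W] by (rule L2_set_le_sum) simp
  also have "\<dots> \<le> (\<Sum>p\<in>(UNIV::'k set). \<Sum>q\<in>(UNIV::'k set). M)"
  proof (rule sum_mono)
    fix p
    have "norm (W $ p) \<le> (\<Sum>q\<in>UNIV. cmod (W $ p $ q))"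
      unfolding norm_vec_def[of "W $ p"] by (rule L2_set_le_sum) simp
    also have "\<dots> \<le> (\<Sum>q\<in>(UNIV::'k set). M)" by (intro sum_mono assms)
    finally show "norm (W $ p) \<le> (\<Sum>q\<in>(UNIV::'k set). M)" .
  qed
  also have "\<dots> = real CARD('k) ^ 2 * M" by (simp add: power2_eq_square)
  finally show ?thesis .
qed

text \<open>Normalising \<open>E\<close> makes the error O(1/N). By compactness some subsequence
  converges; its limit vector has norm 1 and is fixed exactly, while the trace bounds, independent
  of \<open>N\<close>, survive the limit.\<close>

lemma exists_block_matrix_limit_eigenvalue_1:
  fixes T :: "(complex^'n^'n) set"
  assumes "bounded T" "r > 0"
    and growth: "\<And>N. N \<ge> 1 \<Longrightarrow> r ^ N \<le> set_opnorm (product_set T N)"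
  obtains W :: "complex^('n \<times> 'n)^('n \<times> 'n)" where "matrix_eigenvalue W 1"
    "\<And>k. cmod (trace (((**) W ^^ k) (mat 1)))
       \<le> real CARD('n) ^ 2 * (set_eigenvalue_modulus (product_set T k) * (real CARD('n) * (4 / r)) ^ k)"
proof -
  define d where "d = real CARD('n)"
  have "d > 0" by (simp add: d_def)
  \<comment> \<open>For empty \<open>T\<close> the norm is 0 by convention, against
    \<open>r > 0\<close>.\<close>
  have "T \<noteq> {}"
    using growth[of 1] \<open>r > 0\<close> by (auto simp: set_opnorm_def sup_nonneg_def product_set_1[unfolded One_nat_def])
  have approx: "\<exists>c t E. (\<forall>i. t i \<in> T) \<and> (\<forall>i j. cmod (c i j) \<le> 4 / r) \<and> real N + 1 \<le> 2 * d ^ 2 * norm E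
      \<and> norm (block_matrix c t *v E - E) \<le> d ^ 2" if "N \<ge> 1" for N
    using exists_approximate_block_eigenvector[OF \<open>bounded T\<close> \<open>T \<noteq> {}\<close> \<open>r > 0\<close> growth[OF that]]
    unfolding d_def by metis
  have "\<exists>c t E. (\<forall>i. t i \<in> T) \<and> (\<forall>i j. cmod (c i j) \<le> 4 / r) \<and> real (Suc N) + 1 \<le> 2 * d ^ 2 * norm E
      \<and> norm (block_matrix c t *v E - E) \<le> d ^ 2" for N
    by (rule approx) simp
  then obtain c t E where t: "\<And>N i. t N i \<in> T" and c: "\<And>N i j. cmod (c N i j) \<le> 4 / r"
    and E: "\<And>N. real (Suc N) + 1 \<le> 2 * d ^ 2 * norm (E N)"
    and err: "\<And>N. norm (block_matrix (c N) (t N) *v E N - E N) \<le> d ^ 2" by metis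
  define W where "W = (\<lambda>N. block_matrix (c N) (t N))"
  define v where "v = (\<lambda>N. E N /\<^sub>R norm (E N))"
  have E0: "norm (E N) > 0" for N
  proof (rule ccontr)
    assume "\<not> norm (E N) > 0"
    then show False using E[of N] by simp
  qed
  then have v1: "norm (v N) = 1" for N by (simp add: v_def)
  \<comment> \<open>The error \<open>d ^ 2\<close> is divided by \<open>norm (E N)\<close>, which is
    at least \<open>Suc N / (2 * d ^ 2)\<close>.\<close>
  have err0: "norm (W N *v v N - v N) \<le> 2 * d ^ 4 / real (Suc N)" for N
  proof -
    have "W N *v v N - v N = (W N *v E N - E N) /\<^sub>R norm (E N)"
      by (simp add: v_def complex_matrix_vector_mult_scaleR scaleR_diff_right)
    then have "norm (W N *v v N - v N) = norm (W N *v E N - E N) / norm (E N)"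
      by (simp add: divide_inverse mult.commute)
    also have "\<dots> \<le> d ^ 2 / norm (E N)" using err[of N] E0[of N] by (simp add: W_def divide_right_mono)
    also have "\<dots> \<le> d ^ 2 / (real (Suc N) / (2 * d ^ 2))"
    proof (intro divide_left_mono mult_pos_pos E0)
      show "real (Suc N) / (2 * d ^ 2) \<le> norm (E N)" using E[of N] \<open>d > 0\<close> by (simp add: field_simps)
    qed (use \<open>d > 0\<close> in auto)
    also have "\<dots> = 2 * d ^ 4 / real (Suc N)" by (simp add: power2_eq_square power4_eq_xxxx)
    finally show ?thesis .
  qed
  obtain B where B: "\<And>s. s \<in> T \<Longrightarrow> norm s \<le> B" using \<open>bounded T\<close> unfolding bounded_iff by blast
  define M where "M = real CARD('n \<times> 'n) ^ 2 * (4 / r * B)"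
  have W_le: "norm (W N) \<le> M" for N
    unfolding M_def
  proof (rule norm_le_of_entries)
    fix p q :: "'n \<times> 'n"
    have "cmod (t N (fst p) $ snd p $ snd q) \<le> B"
      using B[OF t[of N "fst p"]] by (meson Finite_Cartesian_Product.norm_nth_le order_trans)
    with c[of N "fst p" "fst q"]
    have "cmod (c N (fst p) (fst q)) * cmod (t N (fst p) $ snd p $ snd q) \<le> 4 / r * B"
      using \<open>r > 0\<close> by (intro mult_mono) auto
    then show "cmod (W N $ p $ q) \<le> 4 / r * B"
      by (simp add: W_def block_matrix_def norm_mult)
  qed
  \<comment> \<open>Working with pairs yields a common subsequence for matrices and vectors.\<close>
  have "norm (W N, v N) \<le> M + 1" for N
    by (intro order_trans[OF norm_Pair_le] add_mono W_le) (simp add: v1)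
  then have "bounded (range (\<lambda>N. (W N, v N)))" unfolding bounded_iff by blast
  then obtain l \<phi> where \<phi>: "strict_mono \<phi>" and l: "((\<lambda>N. (W N, v N)) \<circ> \<phi>) \<longlonglongrightarrow> l"
    using bounded_imp_convergent_subsequence by blast
  define W' v' where "W' = fst l" and "v' = snd l"
  have W': "(\<lambda>N. W (\<phi> N)) \<longlonglongrightarrow> W'" using tendsto_fst[OF l] by (simp add: W'_def comp_def)
  have v': "(\<lambda>N. v (\<phi> N)) \<longlonglongrightarrow> v'" using tendsto_snd[OF l] by (simp add: v'_def comp_def)
  have "(\<lambda>N. norm (v (\<phi> N))) \<longlonglongrightarrow> norm v'" by (intro tendsto_norm v')
  then have "norm v' = 1" using v1 by (simp add: LIMSEQ_const_iff)
  have null: "(\<lambda>N. 2 * d ^ 4 / real (Suc N)) \<longlonglongrightarrow> 0"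
    by (rule LIMSEQ_Suc[OF lim_const_over_n])
  have "(\<lambda>N. W N *v v N - v N) \<longlonglongrightarrow> 0"
    by (rule Lim_null_comparison[OF always_eventually[OF allI[OF err0]] null])
  from LIMSEQ_subseq_LIMSEQ[OF this \<phi>] have "(\<lambda>N. W (\<phi> N) *v v (\<phi> N) - v (\<phi> N)) \<longlonglongrightarrow> 0"
    by (simp add: comp_def)
  moreover have "(\<lambda>N. W (\<phi> N) *v v (\<phi> N) - v (\<phi> N)) \<longlonglongrightarrow> W' *v v' - v'"
    by (intro tendsto_diff tendsto_matrix_vector_mult W' v')
  ultimately have "W' *v v' - v' = 0" using LIMSEQ_unique by blast
  then have "matrix_eigenvalue W' 1"
    unfolding matrix_eigenvalue_def using \<open>norm v' = 1\<close> by (intro exI[of _ v']) auto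
  moreover have "cmod (trace (((**) W' ^^ k) (mat 1)))
       \<le> d ^ 2 * (set_eigenvalue_modulus (product_set T k) * (d * (4 / r)) ^ k)" for k
  proof (rule LIMSEQ_le_const2)
    have "(\<lambda>N. ((**) (W (\<phi> N)) ^^ k) (mat 1)) \<longlonglongrightarrow> ((**) W' ^^ k) (mat 1)"
      by (induction k) (auto intro: tendsto_matrix_mult W')
    then show "(\<lambda>N. cmod (trace (((**) (W (\<phi> N)) ^^ k) (mat 1)))) \<longlonglongrightarrow> cmod (trace (((**) W' ^^ k) (mat 1)))"
      unfolding trace_def by (intro tendsto_intros)
    show "\<exists>M. \<forall>N\<ge>M. cmod (trace (((**) (W (\<phi> N)) ^^ k) (mat 1)))
       \<le> d ^ 2 * (set_eigenvalue_modulus (product_set T k) * (d * (4 / r)) ^ k)"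
      unfolding W_def d_def
      by (intro exI allI impI trace_block_matrix_power_le[OF \<open>bounded T\<close>] t c)
  qed
  ultimately show ?thesis using that[of W'] unfolding d_def by blast
qed

section \<open>Lower bounds for eigenvalues of products\<close>

text \<open>The constant is tuned to Newton's identities in dimension D = d^2: the product of r /
  (8d^3) and 4d/r is 1 / (2d^2), the largest \<delta> with D\<delta> \<le> 1/2. Otherwise the limit
  block matrix could not have the eigenvalue 1.\<close>

lemma exists_large_eigenvalue:
  fixes T :: "(complex^'n^'n) set"
  assumes "bounded T" "r > 0"
    and "\<And>N. N \<ge> 1 \<Longrightarrow> r ^ N \<le> set_opnorm (product_set T N)"
  obtains k where "k \<in> {1..CARD('n) ^ 2}"
    "(r / (8 * real CARD('n) ^ 3)) ^ k \<le> set_eigenvalue_modulus (product_set T k)"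
proof (rule ccontr)
  note witness = that
  assume "\<not> thesis"
  then have small: "set_eigenvalue_modulus (product_set T k) \<le> (r / (8 * real CARD('n) ^ 3)) ^ k"
    if "k \<in> {1..CARD('n) ^ 2}" for k
    using witness[OF that] by linarith
  define d where "d = real CARD('n)"
  have "d > 0" by (simp add: d_def)
  obtain W :: "complex^('n \<times> 'n)^('n \<times> 'n)" where W: "matrix_eigenvalue W 1"
    "\<And>k. cmod (trace (((**) W ^^ k) (mat 1)))
       \<le> d ^ 2 * (set_eigenvalue_modulus (product_set T k) * (d * (4 / r)) ^ k)"
    using exists_block_matrix_limit_eigenvalue_1[OF assms] unfolding d_def by metis
  obtain es where es: "length es = CARD('n \<times> 'n)"
    "\<And>m. trace (((**) W ^^ m) (mat 1)) = (\<Sum>x\<leftarrow>es. x ^ m)" "\<And>c. matrix_eigenvalue W c \<longleftrightarrow> c \<in> set es"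
    using complex_matrix_eigenvalue_list[of W] by metis
  have D: "real (CARD('n) ^ 2) = d ^ 2" by (simp add: d_def)
  have "1 \<notin> set es"
  proof (rule power_sums_small_imp_one_notin[where D = "CARD('n) ^ 2" and \<delta> = "1 / (2 * d ^ 2)"])
    fix k assume k: "k \<in> {1..CARD('n) ^ 2}"
    have "cmod (\<Sum>x\<leftarrow>es. x ^ k) \<le> d ^ 2 * (set_eigenvalue_modulus (product_set T k) * (d * (4 / r)) ^ k)"
      using W(2)[of k] es(2)[of k] by simp
    also have "\<dots> \<le> d ^ 2 * ((r / (8 * d ^ 3)) ^ k * (d * (4 / r)) ^ k)"
      using small[OF k] \<open>d > 0\<close> \<open>r > 0\<close> unfolding d_def by (intro mult_left_mono mult_right_mono) auto
    also have "(r / (8 * d ^ 3)) ^ k * (d * (4 / r)) ^ k = (1 / (2 * d ^ 2)) ^ k"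
      using \<open>d > 0\<close> \<open>r > 0\<close> unfolding power_mult_distrib[symmetric]
      by (simp add: field_simps power2_eq_square power3_eq_cube)
    finally show "cmod (\<Sum>x\<leftarrow>es. x ^ k) \<le> real (CARD('n) ^ 2) * (1 / (2 * d ^ 2)) ^ k" unfolding D .
  qed (use es(1) \<open>d > 0\<close> in \<open>simp_all add: d_def power2_eq_square\<close>)
  then show False using W(1) es(3) by simp
qed

text \<open>The previous bound is applied to the q-fold product set, with the q-th power of the
  joint spectral radius as growth rate.\<close>

lemma product_set_eigenvalue_lower_bound:
  fixes S :: "(complex^'n^'n) set"
  assumes "bounded S" "q \<ge> 1"
  obtains k where "k \<in> {1..CARD('n) ^ 2}"
    "(joint_spectral_radius S ^ q / (8 * real CARD('n) ^ 3)) ^ k \<le> set_eigenvalue_modulus (product_set S (q * k))"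
proof (cases "joint_spectral_radius S = 0")
  \<comment> \<open>A growth rate must be positive; here the left side vanishes and
    \<open>k = 1\<close> works.\<close>
  case True
  then show ?thesis
    using that[of 1] set_eigenvalue_modulus_product_set(1)[OF assms(1), of q] assms(2)
    by (simp add: zero_power)
next
  case False
  let ?T = "product_set S q"
  have "joint_spectral_radius S > 0" using False joint_spectral_radius_power_le(1)[OF assms(1)] by simp
  then have "joint_spectral_radius S ^ q > 0" by simp
  \<comment> \<open>Operator norms control entries, because entry \<open>(i, j)\<close> is
    coordinate \<open>i\<close> of the image of the j-th unit vector.\<close>
  moreover have "bounded ?T"
  proof -
    obtain B where B: "\<And>w. w \<in> ?T \<Longrightarrow> onorm ((*v) w) \<le> B"
      using bdd_above_onorm_product_set[OF bdd_above_onorm[OF \<open>bounded S\<close>], of q] unfolding bdd_above_def by auto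
    have "norm w \<le> real CARD('n) ^ 2 * B" if "w \<in> ?T" for w
    proof (rule norm_le_of_entries)
      fix i j
      have "cmod (w $ i $ j) = cmod ((w *v axis j 1) $ i)"
        by (simp add: matrix_vector_mult_def axis_def if_distrib cong: if_cong)
      also have "\<dots> \<le> norm (w *v axis j 1)" by (rule Finite_Cartesian_Product.norm_nth_le)
      also have "\<dots> \<le> onorm ((*v) w) * norm (axis j (1::complex))" by (rule onorm) simp
      also have "\<dots> \<le> B" using B[OF that] by simp
      finally show "cmod (w $ i $ j) \<le> B" .
    qed
    then show ?thesis unfolding bounded_iff by blast
  qed
  moreover have "(joint_spectral_radius S ^ q) ^ N \<le> set_opnorm (product_set ?T N)" if "N \<ge> 1" for N
    using joint_spectral_radius_power_le(2)[OF assms(1), of "q * N"] assms(2) that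
    by (simp add: product_set_mult power_mult)
  ultimately obtain k where "k \<in> {1..CARD('n) ^ 2}"
    "(joint_spectral_radius S ^ q / (8 * real CARD('n) ^ 3)) ^ k \<le> set_eigenvalue_modulus (product_set ?T k)"
    using exists_large_eigenvalue[of ?T "joint_spectral_radius S ^ q"] by blast
  then show ?thesis using that by (simp add: product_set_mult)
qed

text \<open>Taking the root of order \<open>q * k\<close> turns the loss \<open>b ^ k\<close> into
  the q-th root of \<open>b\<close>, which is at most \<open>a\<close>.\<close>

lemma root_bound:
  assumes "\<rho> \<ge> (0::real)" "b > 0" "k \<ge> 1" "q \<ge> 1" "(\<rho> ^ q / b) ^ k \<le> x" and a: "a > 0" "b \<le> a ^ q"
  shows "1 / a * \<rho> \<le> root (q * k) x"
proof -
  have "(1 / a * \<rho>) ^ (q * k) = (\<rho> ^ q / a ^ q) ^ k"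
    by (simp add: power_mult power_divide)
  also have "\<dots> \<le> (\<rho> ^ q / b) ^ k"
    using assms by (intro power_mono divide_left_mono) auto
  also have "\<dots> \<le> x" by fact
  finally have "root (q * k) ((1 / a * \<rho>) ^ (q * k)) \<le> root (q * k) x"
    using assms by (intro real_root_le_mono) auto
  moreover have "root (q * k) ((1 / a * \<rho>) ^ (q * k)) = 1 / a * \<rho>"
    using assms by (intro real_root_power_cancel) auto
  ultimately show ?thesis by simp
qed

theorem theorem5:
  fixes S :: "(complex^'n^'n) set"
  assumes "bounded S"
  shows "(MAX k\<in>{1..2 * CARD('n)^3}. root k (set_eigenvalue_modulus (product_set S k)))
           \<ge> 1 / (2^8 * real CARD('n)^5) * joint_spectral_radius S
       \<and> (MAX k\<in>{1..N2_bound CARD('n)}. root k (set_eigenvalue_modulus (product_set S k)))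
           \<ge> 1 / 2 * joint_spectral_radius S"
proof
  let ?f = "\<lambda>k. root k (set_eigenvalue_modulus (product_set S k))"
  define d where "d = real CARD('n)"
  have "CARD('n) \<ge> 1" by (simp add: Suc_leI)
  then have d1: "d \<ge> 1" by (simp add: d_def)
  \<comment> \<open>This comparison gives the first inequality with \<open>q = 1\<close> and also
    feeds the choice of \<open>q\<close> in the second.\<close>
  have b_le: "8 * d ^ 3 \<le> 2 ^ 8 * d ^ 5"
    using d1 by (intro mult_mono power_increasing) auto
  have \<rho>: "joint_spectral_radius S \<ge> 0" using joint_spectral_radius_power_le(1)[OF assms] .
  have d23: "CARD('n) ^ 2 \<le> 2 * CARD('n) ^ 3"
    using power_increasing[of 2 3 "CARD('n)"] \<open>CARD('n) \<ge> 1\<close> by linarith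
  have Max: "y \<le> (MAX k\<in>{1..N}. ?f k)" if "y \<le> ?f k" "k \<in> {1..N}" for y k N
    using that by (meson Max_ge finite_atLeastAtMost finite_imageI imageI order_trans)
  obtain k where k: "k \<in> {1..CARD('n) ^ 2}"
    "(joint_spectral_radius S ^ 1 / (8 * d ^ 3)) ^ k \<le> set_eigenvalue_modulus (product_set S (1 * k))"
    using product_set_eigenvalue_lower_bound[OF assms, of 1] unfolding d_def by blast
  have "1 / (2^8 * d^5) * joint_spectral_radius S \<le> ?f k"
    using root_bound[OF \<rho> _ _ _ k(2), of "2^8 * d^5"] k(1) d1 b_le by simp
  then show "1 / (2^8 * real CARD('n)^5) * joint_spectral_radius S \<le> (MAX k\<in>{1..2 * CARD('n)^3}. ?f k)"
    unfolding d_def using k(1) d23 by (intro Max[of _ k]) auto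
  \<comment> \<open>This factor of \<open>N2_bound\<close> makes \<open>2 ^ q\<close> at least
    \<open>2 ^ 8 * d ^ 5\<close>, so taking roots costs at most a factor 2.\<close>
  define q where "q = nat \<lceil>8 + 5 * log 2 d\<rceil>"
  have "log 2 d \<ge> 0" using d1 by simp
  have q: "real q \<ge> 8 + 5 * log 2 d" unfolding q_def by linarith
  then have "q \<ge> 1" using \<open>log 2 d \<ge> 0\<close> by linarith
  have "2 ^ 8 * d ^ 5 = 2 powr (8 + 5 * log 2 d)"
  proof -
    have "2 powr (5 * log 2 d) = (2 powr log 2 d) powr 5" by (simp add: powr_powr mult.commute)
    then show ?thesis using d1 by (simp add: powr_add powr_numeral)
  qed
  also have "\<dots> \<le> 2 powr real q" using q by (intro powr_mono) auto
  also have "\<dots> = 2 ^ q" by (simp add: powr_realpow)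
  finally have bq: "8 * d ^ 3 \<le> 2 ^ q" using b_le by linarith
  obtain k where k: "k \<in> {1..CARD('n) ^ 2}"
    "(joint_spectral_radius S ^ q / (8 * d ^ 3)) ^ k \<le> set_eigenvalue_modulus (product_set S (q * k))"
    using product_set_eigenvalue_lower_bound[OF assms \<open>q \<ge> 1\<close>] unfolding d_def by blast
  have "1 / 2 * joint_spectral_radius S \<le> ?f (q * k)"
    using root_bound[OF \<rho> _ _ \<open>q \<ge> 1\<close> k(2), of 2] k(1) d1 bq by simp
  moreover have "q * k \<in> {1..N2_bound CARD('n)}"
  proof -
    have "q * k \<le> q * (2 * CARD('n) ^ 3)" using k(1) d23 by (intro mult_left_mono) auto
    then show ?thesis using k(1) \<open>q \<ge> 1\<close> by (simp add: N2_bound_def q_def d_def mult_ac Suc_leI)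
  qed
  ultimately show "1 / 2 * joint_spectral_radius S \<le> (MAX k\<in>{1..N2_bound CARD('n)}. ?f k)"
    by (rule Max)
qed

end
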